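(* Let $\Gamma=(\mathcal{P},\mathcal{L},\mathtt{I})$ be a finite weak generalised $2m$-gon of order $(s,t)$ with $m\ge2$ and $s\le t$. Let $C$ be a set of points such that $C\cap\mathcal{P}_{\le 2m-2}(v)\neq\emptyset$ for every point $v\in\mathcal{P}$. Then $|C|\ge s+1$. If $|C|=s+1$, then $C=T_{d,x,y}$ for some opposite elements $x,y$ of $\Gamma$ and some $d\in\{1,\dots,m\}$. Furthermore, if $|C|=s+1$ and $s<t$, then $d$ is odd.
   Context: A point-line geometry $\Gamma=(\mathcal{P},\mathcal{L},\mathtt{I})$ has points, lines and a symmetric incidence relation; an element is a point or a line; $\delta(x,y)$ is the distance in the bipartite incidence graph on $\mathcal{P}\cup\mathcal{L}$. A weak generalised $n$-gon ($n\ge3$) is a point-line geometry with no ordinary $k$-gon as subgeometry for $2\le k<n$ and in which any two elements lie in a common ordinary $n$-gon (its incidence graph has diameter $n$ and girth $2n$). Order $(s,t)$, $s,t\ge1$: every line has exactly $s+1$ points, every point is on exactly $t+1$ lines. Elements are opposite if at distance $n$. $\mathcal{P}_i(x)$ and $\mathcal{P}_{\le i}(x)$ denote the sets of points at distance exactly $i$, resp. at most $i$, from the element $x$. For $d\in\{1,\dots,m\}$ and opposite elements $x,y$, the distance $d$-trace is the (nonempty) set $T_{d,x,y}=\mathcal{P}_d(x)\cap\mathcal{P}_{2m-d}(y)$. *)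

theory Defs
  imports Main "HOL-Library.Extended_Nat"
begin

record 'a geometry =
  points :: "'a set"
  lines :: "'a set"
  incid :: "('a \<times> 'a) set"

definition point_line_geometry :: "'a geometry \<Rightarrow> bool" where
  "point_line_geometry \<Gamma> \<longleftrightarrow>
     points \<Gamma> \<noteq> {} \<and> lines \<Gamma> \<noteq> {} \<and> points \<Gamma> \<inter> lines \<Gamma> = {} \<and>
     sym (incid \<Gamma>) \<and>
     incid \<Gamma> \<subseteq> points \<Gamma> \<times> lines \<Gamma> \<union> lines \<Gamma> \<times> points \<Gamma>"

definition elements :: "'a geometry \<Rightarrow> 'a set" where
  "elements \<Gamma> = points \<Gamma> \<union> lines \<Gamma>"

definition finite_geometry :: "'a geometry \<Rightarrow> bool" where
  "finite_geometry \<Gamma> \<longleftrightarrow> finite (points \<Gamma>) \<and> finite (lines \<Gamma>)"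

text \<open>Incidence is induced from the ambient geometry.\<close>

definition subgeometry :: "'a geometry \<Rightarrow> 'a geometry \<Rightarrow> bool" where
  "subgeometry \<Delta> \<Gamma> \<longleftrightarrow>
     point_line_geometry \<Delta> \<and>
     points \<Delta> \<subseteq> points \<Gamma> \<and> lines \<Delta> \<subseteq> lines \<Gamma> \<and>
     incid \<Delta> = incid \<Gamma> \<inter> (elements \<Delta> \<times> elements \<Delta>)"

text \<open>The line \<open>l j\<close> joins the consecutive vertices \<open>p j\<close> and \<open>p (j + 1)\<close>, indices modulo \<open>k\<close>.\<close>

definition ordinary_polygon :: "nat \<Rightarrow> 'a geometry \<Rightarrow> bool" where
  "ordinary_polygon k \<Delta> \<longleftrightarrow>
     k \<ge> 2 \<and> point_line_geometry \<Delta> \<and>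
     (\<exists>p l. bij_betw p {..<k} (points \<Delta>) \<and> bij_betw l {..<k} (lines \<Delta>) \<and>
        (\<forall>i<k. \<forall>j<k. (p i, l j) \<in> incid \<Delta> \<longleftrightarrow> i = j \<or> i = Suc j mod k))"

definition weak_generalised_polygon :: "nat \<Rightarrow> 'a geometry \<Rightarrow> bool" where
  "weak_generalised_polygon n \<Gamma> \<longleftrightarrow>
     n \<ge> 3 \<and> point_line_geometry \<Gamma> \<and>
     (\<forall>k. 2 \<le> k \<and> k < n \<longrightarrow> \<not> (\<exists>\<Delta>. subgeometry \<Delta> \<Gamma> \<and> ordinary_polygon k \<Delta>)) \<and>
     (\<forall>x\<in>elements \<Gamma>. \<forall>y\<in>elements \<Gamma>.
        \<exists>\<Delta>. subgeometry \<Delta> \<Gamma> \<and> ordinary_polygon n \<Delta> \<and> x \<in> elements \<Delta> \<and> y \<in> elements \<Delta>)"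

definition has_order :: "'a geometry \<Rightarrow> nat \<Rightarrow> nat \<Rightarrow> bool" where
  "has_order \<Gamma> s t \<longleftrightarrow>
     s \<ge> 1 \<and> t \<ge> 1 \<and>
     (\<forall>l\<in>lines \<Gamma>. card {p \<in> points \<Gamma>. (p, l) \<in> incid \<Gamma>} = s + 1) \<and>
     (\<forall>p\<in>points \<Gamma>. card {l \<in> lines \<Gamma>. (p, l) \<in> incid \<Gamma>} = t + 1)"

text \<open>The relational power \<open>incid \<Gamma> ^^ k\<close> relates the ends of walks of length \<open>k\<close> in the incidence
  graph; the infimum is \<open>\<infinity>\<close> when there is no walk.\<close>

definition gdist :: "'a geometry \<Rightarrow> 'a \<Rightarrow> 'a \<Rightarrow> enat" where
  "gdist \<Gamma> x y = (INF k\<in>{k. (x, y) \<in> incid \<Gamma> ^^ k}. enat k)"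

definition opposite :: "nat \<Rightarrow> 'a geometry \<Rightarrow> 'a \<Rightarrow> 'a \<Rightarrow> bool" where
  "opposite n \<Gamma> x y \<longleftrightarrow> x \<in> elements \<Gamma> \<and> y \<in> elements \<Gamma> \<and> gdist \<Gamma> x y = enat n"

definition points_at :: "'a geometry \<Rightarrow> nat \<Rightarrow> 'a \<Rightarrow> 'a set" where
  "points_at \<Gamma> i x = {p \<in> points \<Gamma>. gdist \<Gamma> x p = enat i}"

definition points_within :: "'a geometry \<Rightarrow> nat \<Rightarrow> 'a \<Rightarrow> 'a set" where
  "points_within \<Gamma> i x = {p \<in> points \<Gamma>. gdist \<Gamma> x p \<le> enat i}"

definition dist_trace :: "'a geometry \<Rightarrow> nat \<Rightarrow> nat \<Rightarrow> 'a \<Rightarrow> 'a \<Rightarrow> 'a set" where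
  "dist_trace \<Gamma> m d x y = points_at \<Gamma> d x \<inter> points_at \<Gamma> (2 * m - d) y"

end

theory Submission
  imports Defs
begin

text \<open>
  If \<open>c\<close> is not opposite \<open>x\<close>, exactly one neighbour of \<open>x\<close>, the projection of \<open>c\<close>, is closer to \<open>c\<close> than
  \<open>x\<close>. If some neighbour of \<open>x\<close> is not a projection of a member of \<open>C\<close>, one can move away from all of
  \<open>C\<close> at once; as no point is opposite all of \<open>C\<close>, this process must get stuck at some \<open>x\<close>, so \<open>C\<close> has
  at least \<open>s + 1\<close> members.

  Let \<open>C\<close> have exactly \<open>s + 1\<close> members. If two members of \<open>C\<close> are both nearest to \<open>x\<close>, then \<open>x\<close> is
  stuck: otherwise after a step away from \<open>C\<close> these two are still nearest but have the same
  projection, so some neighbour is again missed, and so on up to a point opposite all of \<open>C\<close>. One more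
  step, towards a farther member, shows that then all of \<open>C\<close> is at the same distance from \<open>x\<close>. This
  applies to the midpoint \<open>x\<close> of a closest pair in \<open>C\<close>, and to an element \<open>y\<close> opposite \<open>x\<close> in an ordinary
  polygon containing \<open>x\<close> and that pair, which exhibits \<open>C\<close> as a distance trace. The trace has as many
  points as \<open>x\<close> has neighbours, whence the parity claim for \<open>s < t\<close>.
\<close>

section \<open>Graphs of diameter \<open>n\<close> with unique short geodesics\<close>

text \<open>Points and lines are treated alike, since a midpoint or a stuck element may be of either
  kind. \<open>d_adj\<close> encodes bipartiteness, \<open>step_unique\<close> the absence of
  ordinary polygons smaller than an \<open>n\<close>-gon, and \<open>degree\<close> is where
  \<open>s \<le> t\<close> enters.\<close>

locale polygon_graph =
  fixes E :: "'a set" and A :: "('a \<times> 'a) set" and d :: "'a \<Rightarrow> 'a \<Rightarrow> nat" and n s :: nat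
  assumes adj_E: "(x, y) \<in> A \<Longrightarrow> x \<in> E \<and> y \<in> E"
    and adj_sym: "(x, y) \<in> A \<Longrightarrow> (y, x) \<in> A"
    and d_zero: "\<lbrakk>x \<in> E; y \<in> E\<rbrakk> \<Longrightarrow> d x y = 0 \<longleftrightarrow> x = y"
    and d_commute: "\<lbrakk>x \<in> E; y \<in> E\<rbrakk> \<Longrightarrow> d x y = d y x"
    and d_triangle: "\<lbrakk>x \<in> E; y \<in> E; z \<in> E\<rbrakk> \<Longrightarrow> d x z \<le> d x y + d y z"
    and d_le: "\<lbrakk>x \<in> E; y \<in> E\<rbrakk> \<Longrightarrow> d x y \<le> n"
    and d_adj: "\<lbrakk>(x, y) \<in> A; c \<in> E\<rbrakk> \<Longrightarrow> d x c = Suc (d y c) \<or> d y c = Suc (d x c)"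
    and step_exists: "\<lbrakk>x \<in> E; y \<in> E; x \<noteq> y\<rbrakk> \<Longrightarrow> \<exists>z. (x, z) \<in> A \<and> d x y = Suc (d z y)"
    and step_unique: "\<lbrakk>y \<in> E; d x y < n; (x, z) \<in> A; (x, z') \<in> A; d x y = Suc (d z y); d x y = Suc (d z' y)\<rbrakk>
      \<Longrightarrow> z = z'"
    and finite_nbrs: "x \<in> E \<Longrightarrow> finite {y. (x, y) \<in> A}"
    and degree: "x \<in> E \<Longrightarrow> s + 1 \<le> card {y. (x, y) \<in> A}"
    and s_pos: "1 \<le> s"
    and E_nonempty: "E \<noteq> {}"
begin

lemma d_self: "x \<in> E \<Longrightarrow> d x x = 0"
  using d_zero by blast

text \<open>A step of \<open>x\<close> towards \<open>y\<close> changes both \<open>d x y\<close>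
  and \<open>d x z\<close> by one, so the parity of the sum survives until \<open>x\<close> reaches
  \<open>y\<close>.\<close>

lemma d_parity:
  assumes "x \<in> E" "y \<in> E" "z \<in> E"
  shows "even (d x y + d y z + d x z)"
  using assms
proof (induction "d x y" arbitrary: x)
  case 0
  then have "x = y" using d_zero by simp
  then show ?case using 0 d_self by simp
next
  case (Suc k)
  then have "x \<noteq> y" using d_self by auto
  then obtain w where w: "(x, w) \<in> A" "d x y = Suc (d w y)"
    using step_exists Suc.prems by blast
  then have "even (d w y + d y z + d w z)"
    using Suc adj_E by auto
  then show ?case using w d_adj[OF w(1) Suc.prems(3)] by auto
qed

text \<open>There are at least two neighbours, and \<open>step_unique\<close> lets at most one of
  them be nearer to \<open>c\<close>.\<close>

lemma step_away:
  assumes "x \<in> E" "c \<in> E" "d x c < n"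
  obtains y where "(x, y) \<in> A" "d y c = Suc (d x c)"
proof -
  let ?N = "{y. (x, y) \<in> A}"
  have "1 < card ?N" using degree[OF assms(1)] s_pos by linarith
  then obtain u v where uv: "u \<in> ?N" "v \<in> ?N" "u \<noteq> v"
    by (metis One_nat_def card_le_Suc0_iff_eq finite_nbrs[OF assms(1)] not_le)
  then show ?thesis using that step_unique[OF assms(2,3), of u v] d_adj[OF _ assms(2)] by blast
qed

text \<open>Stepping away from \<open>c\<close> is possible until distance \<open>n\<close>; the
  triangle inequality forces the steps taken to form a geodesic from \<open>x\<close> to
  \<open>e\<close>.\<close>

lemma extend_geodesic:
  assumes "x \<in> E" "c \<in> E"
  obtains e where "e \<in> E" "d e c = n" "d e x + d x c = n"
proof -
  have "\<exists>e\<in>E. d e c = n \<and> d e x + d x c = n"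
    using assms
  proof (induction "n - d x c" arbitrary: x)
    case 0
    then have "d x c = n" using d_le[of x c] by simp
    then show ?case using 0 d_self by (intro bexI[of _ x]) auto
  next
    case (Suc k)
    then have "d x c < n" by simp
    then obtain y where y: "(x, y) \<in> A" "d y c = Suc (d x c)"
      using step_away Suc.prems by blast
    then have yE: "y \<in> E" and "k = n - d y c" using adj_E Suc(2) by auto
    with Suc obtain e where e: "e \<in> E" "d e c = n" "d e y + d y c = n" by blast
    have "d e x \<le> Suc (d e y)"
      using d_adj[OF y(1) e(1)] d_commute e(1) yE Suc.prems(1) by auto
    moreover have "n \<le> d e x + d x c" using d_triangle[of e x c] e Suc.prems by simp
    ultimately show ?case using e y by (intro bexI[of _ e]) auto
  qed
  then show ?thesis using that by blast
qed

lemma point_on_geodesic: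
  assumes "x \<in> E" "y \<in> E" "i \<le> d x y"
  obtains z where "z \<in> E" "d x z = i" "d z y = d x y - i"
proof -
  have "\<exists>z\<in>E. d x z = i \<and> d z y = d x y - i"
    using assms(3)
  proof (induction i)
    case 0
    then show ?case using assms d_self by (intro bexI[of _ x]) auto
  next
    case (Suc i)
    then obtain z where z: "z \<in> E" "d x z = i" "d z y = d x y - i" by auto
    then have "z \<noteq> y" using Suc.prems d_self by auto
    then obtain w where w: "(z, w) \<in> A" "d z y = Suc (d w y)"
      using step_exists z assms by blast
    then have wE: "w \<in> E" using adj_E by blast
    have "d x w \<le> Suc i"
      using d_adj[OF w(1) assms(1)] d_commute z wE assms(1) by auto
    moreover have "d x y \<le> d x w + d w y" using d_triangle wE assms by blast
    ultimately show ?case using w z Suc.prems wE by (intro bexI[of _ w]) auto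
  qed
  then show ?thesis using that by blast
qed

text \<open>The first steps from \<open>u\<close> towards \<open>p\<close> and towards
  \<open>q\<close> are also steps towards \<open>y\<close>, so they coincide.\<close>

lemma geodesic_point_unique:
  assumes "u \<in> E" "y \<in> E" "p \<in> E" "q \<in> E" "d u y < n"
    "d u p + d p y = d u y" "d u q + d q y = d u y" "d u p = d u q"
  shows "p = q"
  using assms
proof (induction "d u p" arbitrary: u)
  case 0
  then show ?case using d_zero by metis
next
  case (Suc k)
  have first: "\<exists>v. (u, v) \<in> A \<and> d u r = Suc (d v r) \<and> d u y = Suc (d v y)"
    if r: "r \<in> E" "d u r + d r y = d u y" "d u r = Suc k" for r
  proof -
    have "u \<noteq> r" using r d_self by auto
    then obtain v where v: "(u, v) \<in> A" "d u r = Suc (d v r)" using step_exists r Suc.prems by blast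
    then have "d v y \<le> d v r + d r y" using d_triangle adj_E r Suc.prems by blast
    then show ?thesis using v d_adj[OF v(1) Suc.prems(2)] r by auto
  qed
  obtain v where v: "(u, v) \<in> A" "d u p = Suc (d v p)" "d u y = Suc (d v y)"
    using first[of p] Suc.prems Suc.hyps(2) by metis
  obtain w where w: "(u, w) \<in> A" "d u q = Suc (d w q)" "d u y = Suc (d w y)"
    using first[of q] Suc.prems Suc.hyps(2) by metis
  have "v = w" using step_unique v w Suc.prems by blast
  moreover have "v \<in> E" using v adj_E by blast
  ultimately show ?case
    by (intro Suc.hyps(1)[of v]) (use Suc.hyps(2) Suc.prems v w in simp_all)
qed

text \<open>Once the walk from \<open>e\<close> to \<open>y\<close> has started by leaving
  \<open>x\<close>, it cannot turn back before distance \<open>n\<close>: the element just left is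
  the unique neighbour nearer to \<open>x\<close>, so the next one is farther.\<close>

lemma geodesic_concat:
  assumes "x \<in> E" "y \<in> E" "(e, w) \<in> A" "d w x = Suc (d e x)" "d e y = Suc (d w y)"
    "d e x + d e y \<le> n"
  shows "d y x = d e x + d e y"
  using assms
proof (induction "d w y" arbitrary: e w)
  case 0
  then have "w = y" using d_zero adj_E by metis
  then show ?case using 0 by simp
next
  case (Suc k)
  then have E: "e \<in> E" "w \<in> E" using adj_E by auto
  then have "w \<noteq> y" using Suc(2) d_self by auto
  then obtain v where v: "(w, v) \<in> A" "d w y = Suc (d v y)"
    using step_exists E Suc.prems by blast
  have "v \<noteq> e" using v Suc.prems by auto
  moreover have "d w x < n" using Suc.prems Suc(2) by linarith
  ultimately have "d w x \<noteq> Suc (d v x)"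
    using step_unique[of x w v e] v(1) Suc.prems adj_sym by metis
  then have "d v x = Suc (d w x)" using d_adj[OF v(1) Suc.prems(1)] by simp
  then show ?case using Suc.hyps(1)[of v w] Suc.hyps(2) Suc.prems v by simp
qed

text \<open>A geodesic to \<open>y\<close> through a neighbour \<open>u\<close> of \<open>x\<close>
  meets the trace in an element at distance \<open>i < n\<close> from \<open>x\<close>, and this
  element determines \<open>u\<close> as its projection.\<close>

lemma degree_le_card_trace:
  assumes "x \<in> E" "y \<in> E" "d x y = n" "1 \<le> i" "2 * i \<le> n" "finite E"
  shows "card {u. (x, u) \<in> A} \<le> card {p \<in> E. d x p = i \<and> d y p = n - i}"
proof -
  have "\<exists>p\<in>E. d x p = i \<and> d y p = n - i \<and> d x p = Suc (d u p)" if u: "(x, u) \<in> A" for u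
  proof -
    have uE: "u \<in> E" using adj_E u by blast
    then have uy: "d u y = n - 1" using d_adj[OF u assms(2)] d_le[OF uE assms(2)] assms by auto
    then have "i - 1 \<le> d u y" using assms by simp
    then obtain p where p: "p \<in> E" "d u p = i - 1" "d p y = n - 1 - (i - 1)"
      using point_on_geodesic[OF uE assms(2)] uy by metis
    moreover have "d x y \<le> d x p + d p y" using d_triangle assms p by blast
    ultimately have "d x p = i" "d p y = n - i" using d_adj[OF u p(1)] assms by auto
    then show ?thesis using p assms d_commute[of p y] by (intro bexI[of _ p]) auto
  qed
  then obtain f where f: "\<And>u. (x, u) \<in> A \<Longrightarrow>
    f u \<in> E \<and> d x (f u) = i \<and> d y (f u) = n - i \<and> d x (f u) = Suc (d u (f u))" by metis
  have "i < n" using assms by simp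
  then have "inj_on f {u. (x, u) \<in> A}"
    by (intro inj_onI) (metis f mem_Collect_eq step_unique)
  then show ?thesis using f assms(6) by (intro card_inj_on_le[of f]) auto
qed

text \<open>The element \<open>y\<close> lies opposite \<open>x\<close> in an ordinary \<open>n\<close>-gon containing the geodesic from \<open>c\<close> to \<open>c'\<close>.\<close>

lemma opposite_midpoint:
  assumes "x \<in> E" "c \<in> E" "c' \<in> E" "d x c = i" "d x c' = i" "d c c' = 2 * i" "1 \<le> i" "2 * i \<le> n"
  obtains y where "y \<in> E" "d x y = n" "d y c = n - i" "d y c' = n - i"
proof -
  \<comment> \<open>\<open>e\<close> prolongs the geodesic from \<open>c'\<close> through
    \<open>c\<close> until it is opposite \<open>c'\<close>.\<close>
  obtain e where e: "e \<in> E" "d e c' = n" "d e c + 2 * i = n"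
    using extend_geodesic[of c c'] assms by metis
  have "d e x \<le> d e c + d c x" "n \<le> d e x + d x c'"
    using d_triangle[of e c x] d_triangle[of e x c'] e assms by auto
  then have ex: "d e x + i = n" using assms e d_commute[of c x] by simp
  \<comment> \<open>Leaving \<open>e\<close> away from \<open>x\<close> starts the other side of the
    polygon; as \<open>e\<close> is opposite \<open>c'\<close>, this step also leads towards
    \<open>c'\<close>.\<close>
  then obtain w where w: "(e, w) \<in> A" "d w x = Suc (d e x)"
    using step_away[of e x] e assms by auto
  have wE: "w \<in> E" using adj_E w by blast
  then have wc': "d w c' = n - 1"
    using d_adj[OF w(1) assms(3)] e d_le[of w c'] assms(3) by auto
  \<comment> \<open>\<open>y\<close> is at distance \<open>i\<close> from \<open>e\<close> on this
    other side: one step to \<open>w\<close>, then \<open>i - 1\<close> more towards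
    \<open>c'\<close>.\<close>
  obtain y where y: "y \<in> E" "d w y = i - 1" "d y c' = n - i"
  proof -
    have "i - 1 \<le> d w c'" "d w c' - (i - 1) = n - i" using assms wc' by auto
    then show ?thesis using point_on_geodesic[OF wE assms(3)] that by metis
  qed
  have "d e y = i"
    using d_adj[OF w(1) y(1)] d_triangle[of e y c'] e y assms by auto
  then have yx: "d y x = n"
    using geodesic_concat[of x y e w] w y assms ex by auto
  have "d y c \<le> d y e + d e c" "d y x \<le> d y c + d c x"
    using d_triangle y e assms by auto
  then have "d y c = n - i"
    using yx \<open>d e y = i\<close> e assms d_commute[of c x] d_commute[of e y] y by auto
  then show ?thesis using that[of y] y yx d_commute[of x y] assms by simp
qed

end

section \<open>Blocking sets\<close>

text \<open>That \<open>C\<close> is a set of points is recorded as \<open>C_parity\<close>;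
  \<open>blocking\<close> ranges over lines too, because a walk away from \<open>C\<close> passes
  through both kinds of elements.\<close>

locale blocking_set = polygon_graph +
  fixes C :: "'a set"
  assumes C_sub: "C \<subseteq> E" and C_fin: "finite C"
    and blocking: "x \<in> E \<Longrightarrow> \<exists>c\<in>C. d x c < n"
    and C_parity: "\<lbrakk>c \<in> C; c' \<in> C\<rbrakk> \<Longrightarrow> even (d c c')"
begin

lemma C_parity_from:
  assumes "x \<in> E" "c \<in> C" "c' \<in> C"
  shows "even (d x c) \<longleftrightarrow> even (d x c')"
proof -
  have "even (d x c + d c c' + d x c')" using d_parity assms C_sub by blast
  then show ?thesis using C_parity[OF assms(2,3)] by simp
qed

lemma card_ge: "s + 1 \<le> card C"
proof (rule ccontr)
  assume less: "\<not> s + 1 \<le> card C"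
  obtain c0 where c0: "c0 \<in> E" using E_nonempty by blast
  have "\<exists>x\<in>E. \<forall>c\<in>C. k \<le> d x c" if "k \<le> n" for k
    using that
  proof (induction k)
    case 0
    then show ?case using c0 by auto
  next
    case (Suc k)
    then obtain x where x: "x \<in> E" "\<forall>c\<in>C. k \<le> d x c" by auto
    show ?case
    proof (rule ccontr)
      assume neg: "\<not> ?thesis"
      \<comment> \<open>Were no member at distance exactly \<open>k\<close>, \<open>x\<close> itself
        would do for \<open>k + 1\<close>; \<open>b\<close> fixes the parity of all distances from
        \<open>x\<close> to \<open>C\<close>.\<close>
      obtain b where "b \<in> C" "\<not> Suc k \<le> d x b" using neg x(1) by blast
      then have b: "b \<in> C" "d x b = k" using x(2) by (auto simp: not_less_eq_eq le_antisym)
      have "\<exists>c\<in>C. d x c < n \<and> d x c = Suc (d y c)" if "(x, y) \<in> A" for y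
      proof -
        \<comment> \<open>A member obstructing the step to \<open>y\<close> is at distance
          \<open>k < n\<close> from \<open>x\<close>, as parity excludes \<open>k + 1\<close>; so
          \<open>y\<close> is its projection.\<close>
        obtain c where c: "c \<in> C" "d y c \<le> k" using neg adj_E[of x y] \<open>(x, y) \<in> A\<close> by force
        then have "k \<le> d x c" "even (d x c) \<longleftrightarrow> even k" using x C_parity_from[of x c b] b by auto
        moreover have "d x c = Suc (d y c) \<or> d y c = Suc (d x c)" using d_adj[OF \<open>(x, y) \<in> A\<close>] C_sub c by blast
        ultimately have "d x c = Suc (d y c)" "d x c \<noteq> Suc k" using c(2) by auto
        then show ?thesis using Suc.prems c by (intro bexI[of _ c]) auto
      qed
      then obtain f where f: "\<And>y. (x, y) \<in> A \<Longrightarrow> f y \<in> C \<and> d x (f y) < n \<and> d x (f y) = Suc (d y (f y))"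
        by metis
      have "inj_on f {y. (x, y) \<in> A}"
        by (intro inj_onI) (metis C_sub f mem_Collect_eq step_unique subsetD)
      then have "card {y. (x, y) \<in> A} \<le> card C"
        using f by (intro card_inj_on_le[OF _ _ C_fin]) auto
      then show False using degree[OF x(1)] less by simp
    qed
  qed
  \<comment> \<open>At \<open>k = n\<close> all of \<open>C\<close> would be opposite one
    element.\<close>
  then show False using blocking by force
qed

end

section \<open>Blocking sets with exactly \<open>s + 1\<close> members\<close>

locale tight_blocking_set = blocking_set +
  assumes card_C: "card C = s + 1"
begin

text \<open>The condition \<open>d x c < n\<close> matters: all neighbours of \<open>x\<close> are closer to an opposite \<open>c\<close>.\<close>

definition stuck :: "'a \<Rightarrow> bool" where
  "stuck x \<longleftrightarrow> (\<forall>y. (x, y) \<in> A \<longrightarrow> (\<exists>c\<in>C. d x c < n \<and> d x c = Suc (d y c)))"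

text \<open>Assigning to each neighbour a member that projects to it is injective; as
  \<open>x\<close> has at least \<open>s + 1 = card C\<close> neighbours, all of \<open>C\<close> is
  used.\<close>

lemma stuck_bij:
  assumes "x \<in> E" "stuck x"
  obtains f where "bij_betw f {y. (x, y) \<in> A} C"
    "\<And>y. (x, y) \<in> A \<Longrightarrow> d x (f y) < n" "\<And>y. (x, y) \<in> A \<Longrightarrow> d x (f y) = Suc (d y (f y))"
proof -
  let ?N = "{y. (x, y) \<in> A}"
  obtain f where f: "\<And>y. (x, y) \<in> A \<Longrightarrow> f y \<in> C \<and> d x (f y) < n \<and> d x (f y) = Suc (d y (f y))"
    using assms(2) unfolding stuck_def by metis
  have inj: "inj_on f ?N"
    by (intro inj_onI) (metis C_sub f mem_Collect_eq step_unique subsetD)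
  have "f ` ?N \<subseteq> C" using f by auto
  moreover have "card (f ` ?N) \<ge> card C"
    using card_image[OF inj] degree[OF assms(1)] card_C by simp
  ultimately have "f ` ?N = C" using C_fin by (meson card_seteq)
  then have "bij_betw f ?N C" using inj by (simp add: bij_betw_def)
  then show ?thesis using that f by blast
qed

text \<open>By the bijection, no member is opposite \<open>x\<close> and no two members share a
  projection.\<close>

lemma stuck_projection:
  assumes "x \<in> E" "stuck x" "c \<in> C"
  obtains y where "(x, y) \<in> A" "d x c = Suc (d y c)" "d x c < n"
    "\<And>c'. c' \<in> C \<Longrightarrow> d x c' = Suc (d y c') \<Longrightarrow> c' = c"
proof -
  obtain f where f: "bij_betw f {y. (x, y) \<in> A} C"
    "\<And>y. (x, y) \<in> A \<Longrightarrow> d x (f y) < n" "\<And>y. (x, y) \<in> A \<Longrightarrow> d x (f y) = Suc (d y (f y))"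
    using stuck_bij[OF assms(1,2)] by blast
  then obtain y where y: "(x, y) \<in> A" "f y = c"
    using assms(3) unfolding bij_betw_def by auto
  have "c' = c" if "c' \<in> C" "d x c' = Suc (d y c')" for c'
  proof -
    obtain y' where y': "(x, y') \<in> A" "f y' = c'"
      using f(1) \<open>c' \<in> C\<close> unfolding bij_betw_def by auto
    then have "y' = y" using step_unique[of c' x y' y] f(2,3)[OF y'(1)] that y(1) C_sub by auto
    then show ?thesis using y y' by simp
  qed
  then show ?thesis using that[of y] y f(2,3)[OF y(1)] by auto
qed

lemma double_min_stuck:
  assumes "x \<in> E" "c1 \<in> C" "c2 \<in> C" "c1 \<noteq> c2" "d x c1 = j" "d x c2 = j" "j < n"
    "\<And>c. c \<in> C \<Longrightarrow> j \<le> d x c"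
  shows "stuck x"
  using assms
proof (induction "n - j" arbitrary: j x)
  case 0
  then show ?case by simp
next
  case (Suc k)
  show ?case
  proof (rule ccontr)
    assume "\<not> stuck x"
    then obtain y where y: "(x, y) \<in> A" "\<And>c. c \<in> C \<Longrightarrow> d x c < n \<Longrightarrow> d x c \<noteq> Suc (d y c)"
      unfolding stuck_def by blast
    have yE: "y \<in> E" using y adj_E by blast
    \<comment> \<open>Members not opposite \<open>x\<close> move one farther. An opposite one comes
      to distance \<open>n - 1\<close>; as \<open>n\<close> then has the parity of
      \<open>j < n\<close>, this is still at least \<open>j + 1\<close>.\<close>
    have up: "Suc j \<le> d y c" if "c \<in> C" for c
    proof -
      have "c \<in> E" using C_sub that by blast
      then show ?thesis
        using y(2)[OF that] d_adj[OF y(1), of c] Suc.prems(8)[OF that] Suc.prems(7)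
          C_parity_from[OF Suc.prems(1) that Suc.prems(2)] Suc.prems(5)
          d_le[of x c] d_le[of y c] yE Suc.prems(1)
        by (cases "d x c < n"; cases "d x c = Suc j") auto
    qed
    \<comment> \<open>\<open>blocking\<close> at \<open>y\<close> keeps the new minimum below
      \<open>n\<close>, so the induction hypothesis applies.\<close>
    obtain c where "c \<in> C" "d y c < n" using blocking yE by blast
    then have lt: "Suc j < n" using up[of c] by simp
    have eq: "d y c1 = Suc j" "d y c2 = Suc j"
      using y d_adj[OF y(1)] Suc.prems C_sub by (metis subsetD)+
    have st: "stuck y"
      by (rule Suc.hyps(1)[of "Suc j"]) (use eq lt up yE Suc.prems Suc.hyps(2) in auto)
    \<comment> \<open>Seen from \<open>y\<close>, both \<open>c1\<close> and \<open>c2\<close>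
      project to \<open>x\<close>, which cannot happen at a stuck element.\<close>
    obtain z where z: "(y, z) \<in> A" "d y c1 = Suc (d z c1)"
       "\<And>c'. c' \<in> C \<Longrightarrow> d y c' = Suc (d z c') \<Longrightarrow> c' = c1"
      using stuck_projection[OF yE st Suc.prems(2)] by metis
    have "z = x"
      using step_unique[of c1 y z x] z(1,2) adj_sym[OF y(1)] eq lt Suc.prems(2,5) C_sub by auto
    then show False using z(3)[of c2] eq Suc.prems by simp
  qed
qed

lemma double_min_equal:
  assumes "x \<in> E" "c1 \<in> C" "c2 \<in> C" "c1 \<noteq> c2" "d x c1 = j" "d x c2 = j" "j < n"
    "\<And>c. c \<in> C \<Longrightarrow> j \<le> d x c" "c \<in> C"
  shows "d x c = j"
proof (rule ccontr)
  assume ne: "d x c \<noteq> j"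
  have st: "stuck x" using double_min_stuck assms by metis
  \<comment> \<open>A step towards \<open>c\<close> takes every other member one farther, since only
    \<open>c\<close> projects to \<open>y\<close>.\<close>
  obtain y where y: "(x, y) \<in> A" "d x c = Suc (d y c)" "d x c < n"
    "\<And>c'. c' \<in> C \<Longrightarrow> d x c' = Suc (d y c') \<Longrightarrow> c' = c"
    using stuck_projection[OF assms(1) st assms(9)] by metis
  have yE: "y \<in> E" using y adj_E by blast
  have up: "d y c' = Suc (d x c')" if "c' \<in> C" "c' \<noteq> c" for c'
    using y(4) d_adj[OF y(1)] that C_sub by (metis subsetD)
  have eq: "d y c1 = Suc j" "d y c2 = Suc j" using up assms ne by metis+
  \<comment> \<open>Parity puts \<open>c\<close> at distance at least \<open>j + 2\<close> from
    \<open>x\<close>, so \<open>c1\<close> and \<open>c2\<close> are still nearest after the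
    step.\<close>
  have "d x c \<noteq> Suc j" using C_parity_from[of x c1 c] assms by auto
  then have "Suc j \<le> d y c" using ne assms(8)[OF assms(9)] y(2) by simp
  then have min: "Suc j \<le> d y c'" if "c' \<in> C" for c'
    using up[OF that] assms(8)[OF that] by (cases "c' = c") auto
  have lt: "Suc j < n" using y(2,3) \<open>Suc j \<le> d y c\<close> by linarith
  have sty: "stuck y"
    using double_min_stuck[OF yE assms(2,3,4) eq lt] min by blast
  obtain z where z: "(y, z) \<in> A" "d y c1 = Suc (d z c1)"
     "\<And>c'. c' \<in> C \<Longrightarrow> d y c' = Suc (d z c') \<Longrightarrow> c' = c1"
    using stuck_projection[OF yE sty assms(2)] by metis
  have "z = x"
    using step_unique[of c1 y z x] z(1,2) adj_sym[OF y(1)] eq lt assms(2,5) C_sub by auto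
  then show False using z(3)[of c2] eq assms by simp
qed

lemma trace_exists:
  obtains x y i where "x \<in> E" "y \<in> E" "d x y = n" "1 \<le> i" "2 * i \<le> n"
    "C = {p \<in> E. d x p = i \<and> d y p = n - i}"
proof -
  define S where "S = {(c, c'). c \<in> C \<and> c' \<in> C \<and> c \<noteq> c'}"
  have "1 < card C" using card_C s_pos by simp
  then have "S \<noteq> {}"
    unfolding S_def using C_fin
    by (metis (mono_tags, lifting) One_nat_def card_le_Suc0_iff_eq case_prodI empty_iff
        mem_Collect_eq not_le)
  define c1 c2 where "c1 = fst (ARG_MIN (\<lambda>(c, c'). d c c') q. q \<in> S)"
    and "c2 = snd (ARG_MIN (\<lambda>(c, c'). d c c') q. q \<in> S)"
  obtain q0 where "q0 \<in> S" using \<open>S \<noteq> {}\<close> by blast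
  note am = arg_min_nat_lemma[where P = "\<lambda>q. q \<in> S" and m = "\<lambda>(c, c'). d c c'", OF this]
  have c12: "c1 \<in> C" "c2 \<in> C" "c1 \<noteq> c2"
    using am unfolding S_def c1_def c2_def by (auto simp: case_prod_beta)
  have closest: "d c1 c2 \<le> d c c'" if "c \<in> C" "c' \<in> C" "c \<noteq> c'" for c c'
    using am that unfolding S_def c1_def c2_def by (auto simp: case_prod_beta)
  have cE: "c1 \<in> E" "c2 \<in> E" using c12 C_sub by auto
  obtain i where i: "d c1 c2 = 2 * i" using C_parity c12 by blast
  have i1: "1 \<le> i" using d_zero[OF cE] i c12(3) by (cases i) auto
  have in': "2 * i \<le> n" using d_le[OF cE] i by simp
  obtain x where x: "x \<in> E" "d c1 x = i" "d x c2 = i"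
    using point_on_geodesic[OF cE, of i] i by auto
  then have x1: "d x c1 = i" using d_commute cE by simp
  \<comment> \<open>A member nearer than \<open>i\<close> to the midpoint would be nearer than
    \<open>2 * i\<close> to \<open>c1\<close>.\<close>
  have xmin: "i \<le> d x c" if "c \<in> C" for c
  proof (cases "c = c1")
    case False
    then have "2 * i \<le> d c1 c" using closest c12 that i by metis
    also have "\<dots> \<le> d c1 x + d x c" using d_triangle x cE that C_sub by blast
    finally show ?thesis using x by simp
  qed (use x1 in simp)
  have iltn: "i < n" using i1 in' by simp
  have xall: "d x c = i" if "c \<in> C" for c
    using double_min_equal[OF x(1) c12 x1 x(3) iltn] xmin that by blast
  have st: "stuck x" using double_min_stuck[OF x(1) c12 x1 x(3) iltn] xmin by blast
  obtain y where y: "y \<in> E" "d x y = n" "d y c1 = n - i" "d y c2 = n - i"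
    using opposite_midpoint[OF x(1) cE x1 x(3) i i1 in'] by blast
  \<comment> \<open>With all of \<open>C\<close> at distance \<open>i\<close> from \<open>x\<close>,
    none is nearer than \<open>n - i\<close> to \<open>y\<close>; so \<open>c1\<close> and
    \<open>c2\<close> are nearest to \<open>y\<close> as well.\<close>
  have "n - i \<le> d y c" if "c \<in> C" for c
  proof -
    have "n \<le> d x c + d c y" using d_triangle[of x c y] x y that C_sub by auto
    then show ?thesis using xall that d_commute[of c y] y C_sub by auto
  qed
  moreover have "n - i < n" using i1 iltn by simp
  ultimately have yall: "d y c = n - i" if "c \<in> C" for c
    using double_min_equal[OF y(1) c12 y(3,4)] that by blast
  \<comment> \<open>The first step \<open>u\<close> from \<open>x\<close> towards \<open>p\<close>
    is the projection of some \<open>f u\<close> in \<open>C\<close>. Both \<open>p\<close> and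
    \<open>f u\<close> lie at distance \<open>i - 1\<close> from \<open>u\<close> on geodesics to
    \<open>y\<close> of length \<open>n - 1\<close>, so they coincide.\<close>
  have "p \<in> C" if p: "p \<in> E" "d x p = i" "d y p = n - i" for p
  proof -
    obtain f where f: "bij_betw f {u. (x, u) \<in> A} C"
      "\<And>u. (x, u) \<in> A \<Longrightarrow> d x (f u) < n" "\<And>u. (x, u) \<in> A \<Longrightarrow> d x (f u) = Suc (d u (f u))"
      using stuck_bij[OF x(1) st] by blast
    have "x \<noteq> p" using p d_self[OF x(1)] i1 by auto
    then obtain u where u: "(x, u) \<in> A" "d x p = Suc (d u p)" using step_exists p x by blast
    have fu: "f u \<in> C" using f(1) u unfolding bij_betw_def by blast
    have du: "d u (f u) = i - 1" using f(3)[OF u(1)] xall[OF fu] by simp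
    have uE: "u \<in> E" using u adj_E by blast
    have uy: "d u y = n - 1"
      using d_adj[OF u(1) y(1)] y d_le[OF uE y(1)] by auto
    have "p = f u"
      by (rule geodesic_point_unique[of u y])
        (use uy uE fu du u p y i1 iltn C_sub d_commute[of _ y] yall in auto)
    then show ?thesis using fu by simp
  qed
  then have "C = {p \<in> E. d x p = i \<and> d y p = n - i}"
    using xall yall C_sub by blast
  then show ?thesis using that x(1) y(1,2) i1 in' by blast
qed

end

section \<open>Incidence graphs of generalised polygons\<close>

text \<open>A natural-number form of \<open>gdist\<close>, meaningful only between elements joined
  by a walk.\<close>

definition walk_dist :: "'a geometry \<Rightarrow> 'a \<Rightarrow> 'a \<Rightarrow> nat" where
  "walk_dist \<Gamma> x y = (LEAST k. (x, y) \<in> incid \<Gamma> ^^ k)"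

lemma gdist_eq_walk_dist:
  assumes "(x, y) \<in> incid \<Gamma> ^^ k"
  shows "gdist \<Gamma> x y = enat (walk_dist \<Gamma> x y)"
proof -
  have "(x, y) \<in> incid \<Gamma> ^^ walk_dist \<Gamma> x y"
    unfolding walk_dist_def using assms by (rule LeastI)
  moreover have "walk_dist \<Gamma> x y \<le> j" if "(x, y) \<in> incid \<Gamma> ^^ j" for j
    unfolding walk_dist_def using that by (rule Least_le)
  ultimately show ?thesis
    unfolding gdist_def by (intro antisym INF_lower2[of "walk_dist \<Gamma> x y"] INF_greatest) auto
qed

lemma walk_dist_le: "(x, y) \<in> incid \<Gamma> ^^ j \<Longrightarrow> walk_dist \<Gamma> x y \<le> j"
  unfolding walk_dist_def by (rule Least_le)

locale connected_geometry =
  fixes \<Gamma> :: "'a geometry"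
  assumes geometry: "point_line_geometry \<Gamma>"
    and connected: "\<lbrakk>x \<in> elements \<Gamma>; y \<in> elements \<Gamma>\<rbrakk> \<Longrightarrow> \<exists>k. (x, y) \<in> incid \<Gamma> ^^ k"
begin

abbreviation "I \<equiv> incid \<Gamma>"
abbreviation "d \<equiv> walk_dist \<Gamma>"

lemma incid_sym: "(x, y) \<in> I \<Longrightarrow> (y, x) \<in> I"
  using geometry unfolding point_line_geometry_def sym_def by blast

lemma incid_elements: "(x, y) \<in> I \<Longrightarrow> x \<in> elements \<Gamma> \<and> y \<in> elements \<Gamma>"
  using geometry unfolding point_line_geometry_def elements_def by blast

lemma incid_bipartite: "(x, y) \<in> I \<Longrightarrow> x \<in> points \<Gamma> \<longleftrightarrow> y \<notin> points \<Gamma>"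
  using geometry unfolding point_line_geometry_def by blast

lemma point_degree:
  assumes "has_order \<Gamma> s t" "x \<in> points \<Gamma>"
  shows "card {y. (x, y) \<in> I} = t + 1"
proof -
  have "{y. (x, y) \<in> I} = {l \<in> lines \<Gamma>. (x, l) \<in> I}"
    using geometry assms(2) unfolding point_line_geometry_def by blast
  then show ?thesis using assms unfolding has_order_def by simp
qed

lemma walk_sym: "(x, y) \<in> I ^^ k \<Longrightarrow> (y, x) \<in> I ^^ k"
proof (induction k arbitrary: y)
  case (Suc k)
  then show ?case using incid_sym by (metis relpow_Suc_E relpow_Suc_I2)
qed simp

lemma walk_parity: "(x, y) \<in> I ^^ k \<Longrightarrow> even k \<longleftrightarrow> (x \<in> points \<Gamma> \<longleftrightarrow> y \<in> points \<Gamma>)"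
proof (induction k arbitrary: y)
  case (Suc k)
  then show ?case using incid_bipartite by (metis even_Suc relpow_Suc_E)
qed simp

lemma walk_d: "\<lbrakk>x \<in> elements \<Gamma>; y \<in> elements \<Gamma>\<rbrakk> \<Longrightarrow> (x, y) \<in> I ^^ d x y"
  unfolding walk_dist_def using connected by (metis LeastI)

lemma even_d:
  "\<lbrakk>x \<in> elements \<Gamma>; y \<in> elements \<Gamma>\<rbrakk> \<Longrightarrow> even (d x y) \<longleftrightarrow> (x \<in> points \<Gamma> \<longleftrightarrow> y \<in> points \<Gamma>)"
  using walk_d walk_parity by blast

lemma d_zero: "\<lbrakk>x \<in> elements \<Gamma>; y \<in> elements \<Gamma>\<rbrakk> \<Longrightarrow> d x y = 0 \<longleftrightarrow> x = y"
  using walk_d[of x y] walk_dist_le[of x y 0] by auto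

lemma d_commute: "\<lbrakk>x \<in> elements \<Gamma>; y \<in> elements \<Gamma>\<rbrakk> \<Longrightarrow> d x y = d y x"
  by (simp add: antisym walk_d walk_dist_le walk_sym)

lemma d_triangle:
  assumes "x \<in> elements \<Gamma>" "y \<in> elements \<Gamma>" "z \<in> elements \<Gamma>"
  shows "d x z \<le> d x y + d y z"
  using walk_d[OF assms(1,2)] walk_d[OF assms(2,3)] by (intro walk_dist_le) (auto simp: relpow_add)

lemma d_adj:
  assumes "(x, y) \<in> I" "c \<in> elements \<Gamma>"
  shows "d x c = Suc (d y c) \<or> d y c = Suc (d x c)"
proof -
  have E: "x \<in> elements \<Gamma>" "y \<in> elements \<Gamma>" using incid_elements assms by auto
  have "d x c \<le> Suc (d y c)" "d y c \<le> Suc (d x c)"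
    using walk_d E assms incid_sym by (meson relpow_Suc_I2 walk_dist_le)+
  moreover have "d x c \<noteq> d y c" using even_d E assms incid_bipartite by metis
  ultimately show ?thesis by linarith
qed

lemma step_exists:
  assumes "x \<in> elements \<Gamma>" "y \<in> elements \<Gamma>" "x \<noteq> y"
  shows "\<exists>z. (x, z) \<in> I \<and> d x y = Suc (d z y)"
proof -
  obtain k where k: "d x y = Suc k" using d_zero assms not0_implies_Suc by metis
  then have "(x, y) \<in> I ^^ Suc k" using walk_d assms by metis
  then obtain z where z: "(x, z) \<in> I" "(z, y) \<in> I ^^ k" by (metis relpow_Suc_E2)
  then show ?thesis using d_adj[OF z(1) assms(2)] walk_dist_le[OF z(2)] k by auto
qed

text \<open>Each step of a shortest walk changes the distance to \<open>y\<close> by one; counting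
  from the start bounds that distance below, counting from the end bounds it above.\<close>

lemma geodesic_exists:
  assumes "x \<in> elements \<Gamma>" "y \<in> elements \<Gamma>" "d x y = k"
  obtains a where "a 0 = x" "a k = y" "\<And>i. i \<le> k \<Longrightarrow> a i \<in> elements \<Gamma> \<and> d (a i) y = k - i"
    "\<And>i. i < k \<Longrightarrow> (a i, a (Suc i)) \<in> I"
proof -
  obtain a where a: "a 0 = x" "a k = y" "\<And>i. i < k \<Longrightarrow> (a i, a (Suc i)) \<in> I"
    using walk_d[OF assms(1,2)] unfolding assms(3) relpow_fun_conv by blast
  have E: "a i \<in> elements \<Gamma>" if "i \<le> k" for i
    using a(3)[of "i - 1"] a(1) incid_elements assms that by (cases i) auto
  have up: "k \<le> d (a i) y + i" if "i \<le> k" for i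
    using that
  proof (induction i)
    case (Suc i)
    then show ?case using d_adj[OF a(3)[of i] assms(2)] by auto
  qed (use a assms in simp)
  have down: "d (a (k - i)) y \<le> i" if "i \<le> k" for i
    using that
  proof (induction i)
    case (Suc i)
    then have "Suc (k - Suc i) = k - i" by simp
    then show ?case using d_adj[OF a(3)[of "k - Suc i"] assms(2)] Suc by auto
  qed (use a assms d_zero in simp)
  have "d (a i) y = k - i" if "i \<le> k" for i
    using up[OF that] down[of "k - i"] that by simp
  then show ?thesis using that a E by blast
qed

text \<open>Chords must be excluded, hence the equivalence in \<open>adj\<close>: a subgeometry
  inherits every ambient incidence among its elements. Starting at a point puts points at even
  positions and lines at odd ones.\<close>

lemma cycle_subpolygon_point:
  assumes k: "2 \<le> k" and inj: "inj_on z {..<2 * k}" and z: "\<And>i. i < 2 * k \<Longrightarrow> z i \<in> elements \<Gamma>"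
    and z0: "z 0 \<in> points \<Gamma>"
    and adj: "\<And>i j. i < 2 * k \<Longrightarrow> j < 2 * k \<Longrightarrow>
      (z i, z j) \<in> I \<longleftrightarrow> j = Suc i mod (2 * k) \<or> i = Suc j mod (2 * k)"
  shows "\<exists>\<Delta>. subgeometry \<Delta> \<Gamma> \<and> ordinary_polygon k \<Delta>"
proof -
  have par: "z i \<in> points \<Gamma> \<longleftrightarrow> even i" if "i < 2 * k" for i
    using that
  proof (induction i)
    case (Suc i)
    then have "(z i, z (Suc i)) \<in> I" using adj[of i "Suc i"] by simp
    then show ?case using incid_bipartite Suc by fastforce
  qed (use z0 in simp)
  define p l where "p i = z (2 * i)" and "l i = z (Suc (2 * i))" for i
  define \<Delta> :: "'a geometry" where "\<Delta> = \<lparr>points = p ` {..<k}, lines = l ` {..<k},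
    incid = I \<inter> ((p ` {..<k} \<union> l ` {..<k}) \<times> (p ` {..<k} \<union> l ` {..<k}))\<rparr>"
  have pP: "p ` {..<k} \<subseteq> points \<Gamma>" using par unfolding p_def by auto
  have lL: "l ` {..<k} \<subseteq> lines \<Gamma>"
  proof -
    have "l i \<in> lines \<Gamma>" if "i < k" for i
    proof -
      have "Suc (2 * i) < 2 * k" using that by simp
      then show ?thesis using par[of "Suc (2 * i)"] z[of "Suc (2 * i)"]
        unfolding l_def elements_def by auto
    qed
    then show ?thesis by auto
  qed
  have disj: "points \<Gamma> \<inter> lines \<Gamma> = {}" using geometry unfolding point_line_geometry_def by blast
  have geo: "point_line_geometry \<Delta>"
    unfolding point_line_geometry_def
  proof (intro conjI)
    show "points \<Delta> \<noteq> {}" "lines \<Delta> \<noteq> {}" using k by (auto simp: \<Delta>_def lessThan_empty_iff)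
    show "points \<Delta> \<inter> lines \<Delta> = {}" using pP lL disj by (auto simp: \<Delta>_def)
    show "sym (incid \<Delta>)" using incid_sym by (auto simp: \<Delta>_def sym_def)
    show "incid \<Delta> \<subseteq> points \<Delta> \<times> lines \<Delta> \<union> lines \<Delta> \<times> points \<Delta>"
    proof (rule subrelI)
      fix x y assume xy: "(x, y) \<in> incid \<Delta>"
      then have "(x, y) \<in> I" "x \<in> points \<Delta> \<union> lines \<Delta>" "y \<in> points \<Delta> \<union> lines \<Delta>"
        by (auto simp: \<Delta>_def)
      moreover have "points \<Delta> \<subseteq> points \<Gamma>" "lines \<Delta> \<inter> points \<Gamma> = {}"
        using pP lL disj by (auto simp: \<Delta>_def)
      ultimately show "(x, y) \<in> points \<Delta> \<times> lines \<Delta> \<union> lines \<Delta> \<times> points \<Delta>"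
        using incid_bipartite by blast
    qed
  qed
  have "subgeometry \<Delta> \<Gamma>"
    unfolding subgeometry_def using geo pP lL by (auto simp: \<Delta>_def elements_def)
  moreover have "ordinary_polygon k \<Delta>"
    unfolding ordinary_polygon_def
  proof (intro conjI exI allI impI)
    have "inj_on p {..<k}"
      by (rule inj_onI) (use inj in \<open>auto simp: p_def dest!: inj_onD\<close>)
    then show "bij_betw p {..<k} (points \<Delta>)" by (simp add: \<Delta>_def bij_betw_def)
    have "inj_on l {..<k}"
      by (rule inj_onI) (use inj in \<open>auto simp: l_def dest!: inj_onD\<close>)
    then show "bij_betw l {..<k} (lines \<Delta>)" by (simp add: \<Delta>_def bij_betw_def)
    fix i j assume ij: "i < k" "j < k"
    have "(p i, l j) \<in> incid \<Delta> \<longleftrightarrow> (z (2 * i), z (Suc (2 * j))) \<in> I"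
      using ij by (auto simp: \<Delta>_def p_def l_def)
    also have "\<dots> \<longleftrightarrow> Suc (2 * j) = Suc (2 * i) mod (2 * k) \<or> 2 * i = Suc (Suc (2 * j)) mod (2 * k)"
      using ij by (intro adj) auto
    also have "Suc (2 * i) mod (2 * k) = Suc (2 * i)" using ij by simp
    also have "Suc (Suc (2 * j)) mod (2 * k) = 2 * (Suc j mod k)"
      by (metis mult_Suc_right mult_mod_right add_2_eq_Suc)
    finally show "(p i, l j) \<in> incid \<Delta> \<longleftrightarrow> i = j \<or> i = Suc j mod k" by auto
  qed (use k geo in auto)
  ultimately show ?thesis by blast
qed

lemma cycle_subpolygon:
  assumes k: "2 \<le> k" and inj: "inj_on z {..<2 * k}" and z: "\<And>i. i < 2 * k \<Longrightarrow> z i \<in> elements \<Gamma>"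
    and adj: "\<And>i j. i < 2 * k \<Longrightarrow> j < 2 * k \<Longrightarrow>
      (z i, z j) \<in> I \<longleftrightarrow> j = Suc i mod (2 * k) \<or> i = Suc j mod (2 * k)"
  shows "\<exists>\<Delta>. subgeometry \<Delta> \<Gamma> \<and> ordinary_polygon k \<Delta>"
proof (cases "z 0 \<in> points \<Gamma>")
  case True
  then show ?thesis using cycle_subpolygon_point assms by blast
next
  case False
  \<comment> \<open>A cycle starting at a line is shifted by one position so that it starts at a
    point.\<close>
  define r where "r i = Suc i mod (2 * k)" for i
  have r: "r i < 2 * k" for i using k by (simp add: r_def)
  have r_inj: "r i = r j \<longleftrightarrow> i = j" if "i < 2 * k" "j < 2 * k" for i j
    using that by (auto simp: r_def mod_Suc split: if_splits)
  have r_Suc: "Suc (r i) mod (2 * k) = r (Suc i mod (2 * k))" for i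
    by (simp add: r_def mod_Suc_eq)
  show ?thesis
  proof (rule cycle_subpolygon_point[OF k])
    show "inj_on (z \<circ> r) {..<2 * k}"
    proof (rule inj_onI)
      fix i j assume ij: "i \<in> {..<2 * k}" "j \<in> {..<2 * k}" "(z \<circ> r) i = (z \<circ> r) j"
      then have "r i = r j" using inj_onD[OF inj, of "r i" "r j"] r by simp
      then show "i = j" using r_inj ij by simp
    qed
    show "(z \<circ> r) i \<in> elements \<Gamma>" for i using z r by simp
    have "(z 0, z 1) \<in> I" using adj[of 0 1] k by simp
    then show "(z \<circ> r) 0 \<in> points \<Gamma>" using incid_bipartite False k by (auto simp: r_def)
    fix i j assume ij: "i < 2 * k" "j < 2 * k"
    have "((z \<circ> r) i, (z \<circ> r) j) \<in> I \<longleftrightarrow> r j = r (Suc i mod (2 * k)) \<or> r i = r (Suc j mod (2 * k))"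
      using adj[OF r r] r_Suc by simp
    then show "((z \<circ> r) i, (z \<circ> r) j) \<in> I \<longleftrightarrow> j = Suc i mod (2 * k) \<or> i = Suc j mod (2 * k)"
      using r_inj ij k by simp
  qed
qed

text \<open>Two geodesics of minimal length with common ends but different first steps form an induced cycle.\<close>

lemma step_unique:
  assumes no_polygon: "\<And>k. 2 \<le> k \<Longrightarrow> k < n \<Longrightarrow> \<not> (\<exists>\<Delta>. subgeometry \<Delta> \<Gamma> \<and> ordinary_polygon k \<Delta>)"
    and "y \<in> elements \<Gamma>" "d x y < n" "(x, u) \<in> I" "(x, v) \<in> I" "d x y = Suc (d u y)" "d x y = Suc (d v y)"
  shows "u = v"
  using assms(2-)
proof (induction "d x y" arbitrary: x y u v rule: less_induct)
  case less
  note IH = less.hyps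
  show ?case
  proof (rule ccontr)
    assume "u \<noteq> v"
    obtain k where k: "d x y = Suc k" using less.prems by blast
    have E: "x \<in> elements \<Gamma>" "u \<in> elements \<Gamma>" "v \<in> elements \<Gamma>"
      using incid_elements less.prems by auto
    have du: "d u y = k" and dv: "d v y = k" using less.prems k by auto
    have "k \<noteq> 0" using du dv d_zero E less.prems(1) \<open>u \<noteq> v\<close> by metis
    obtain a' where a': "a' 0 = u" "a' k = y" "\<And>i. i \<le> k \<Longrightarrow> a' i \<in> elements \<Gamma> \<and> d (a' i) y = k - i"
      "\<And>i. i < k \<Longrightarrow> (a' i, a' (Suc i)) \<in> I" using geodesic_exists[OF E(2) less.prems(1) du] by metis
    obtain b' where b': "b' 0 = v" "b' k = y" "\<And>i. i \<le> k \<Longrightarrow> b' i \<in> elements \<Gamma> \<and> d (b' i) y = k - i"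
      "\<And>i. i < k \<Longrightarrow> (b' i, b' (Suc i)) \<in> I" using geodesic_exists[OF E(3) less.prems(1) dv] by metis
    \<comment> \<open>\<open>K\<close> is \<open>d x y\<close>; the geodesics \<open>a\<close>
      through \<open>u\<close> and \<open>b\<close> through \<open>v\<close> will close up to a
      cycle of length \<open>2 * K\<close> with \<open>K < n\<close>.\<close>
    define K where "K = Suc k"
    define a b where "a = case_nat x a'" and "b = case_nat x b'"
    have K: "2 \<le> K" "K < n" using \<open>k \<noteq> 0\<close> less.prems k by (auto simp: K_def)
    have a: "a 0 = x" "a 1 = u" "a K = y" "\<And>i. i \<le> K \<Longrightarrow> a i \<in> elements \<Gamma>"
      "\<And>i. i \<le> K \<Longrightarrow> d (a i) y = K - i" "\<And>i. i < K \<Longrightarrow> (a i, a (Suc i)) \<in> I"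
      using a' E k less.prems by (auto simp: a_def K_def split: nat.split)
    have b: "b 0 = x" "b 1 = v" "b K = y" "\<And>i. i \<le> K \<Longrightarrow> b i \<in> elements \<Gamma>"
      "\<And>i. i \<le> K \<Longrightarrow> d (b i) y = K - i" "\<And>i. i < K \<Longrightarrow> (b i, b (Suc i)) \<in> I"
      using b' E k less.prems by (auto simp: b_def K_def split: nat.split)
    have level: "i = j" if "d p y = K - i" "d p y = K - j" "i \<le> K" "j \<le> K" for p i j
      using that by simp
    have adj_level: "i = Suc j \<or> j = Suc i"
      if "(p, q) \<in> I" "d p y = K - i" "d q y = K - j" "i \<le> K" "j \<le> K" for p q i j
      using d_adj[OF that(1) less.prems(1)] that by auto
    \<comment> \<open>A common inner element would be nearer to \<open>x\<close> than
      \<open>y\<close> is and still have both \<open>u\<close> and \<open>v\<close> as first steps,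
      against the induction hypothesis.\<close>
    have meet: "a i \<noteq> b j" if "0 < i" "i < K" "j \<le> K" for i j
    proof
      assume eq: "a i = b j"
      then have ij: "i = j" using level[of "a i" i j] a(5)[of i] b(5)[of j] that by auto
      have walk: "d (c 1) (c i) \<le> i - 1" if "\<And>j. j < K \<Longrightarrow> (c j, c (Suc j)) \<in> I" for c :: "nat \<Rightarrow> 'a"
      proof (rule walk_dist_le)
        show "(c 1, c i) \<in> I ^^ (i - 1)"
          unfolding relpow_fun_conv
          by (rule exI[of _ "\<lambda>j. c (Suc j)"]) (use that \<open>0 < i\<close> \<open>i < K\<close> in auto)
      qed
      have aE: "a i \<in> elements \<Gamma>" using a(4) that by simp
      have "d x y \<le> d x (a i) + d (a i) y" using d_triangle E aE less.prems(1) by blast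
      then have "i \<le> d x (a i)" using a(5)[of i] k that K_def by auto
      moreover have "d u (a i) \<le> i - 1" using walk[of a] a by auto
      moreover have "d v (a i) \<le> i - 1" using walk[of b] b eq ij by auto
      ultimately have uv: "d x (a i) = Suc (d u (a i))" "d x (a i) = Suc (d v (a i))" "d x (a i) = i"
        using d_adj[OF less.prems(3) aE] d_adj[OF less.prems(4) aE] that by auto
      then have "d x (a i) < d x y" using k that K_def by auto
      then have "u = v"
        using IH[of x "a i" u v] aE less.prems uv by auto
      then show False using \<open>u \<noteq> v\<close> by blast
    qed
    \<comment> \<open>A cross edge would give an element nearer to \<open>y\<close> than
      \<open>x\<close> is, with two different steps towards \<open>y\<close>.\<close>
    have chord: False
      if pq: "(p, q) \<in> I" "(p, q') \<in> I" "q \<noteq> q'" "d p y = K - j" "d q y = K - Suc j" "d q' y = K - Suc j"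
        "0 < j" "Suc j \<le> K" for p q q' j
    proof -
      have "d p y < d x y" using pq k K_def by auto
      moreover have "K - j = Suc (K - Suc j)" using pq by simp
      ultimately have "q = q'" using IH[of p y q q'] pq less.prems by auto
      then show False using pq by blast
    qed
    \<comment> \<open>Along \<open>a\<close> from \<open>x\<close> to \<open>y\<close>, then back
      along \<open>b\<close>; the indices \<open>2 * K - i\<close> with \<open>K < i < 2 * K\<close>
      run through the inner elements of \<open>b\<close> only.\<close>
    define z where "z i = (if i \<le> K then a i else b (2 * K - i))" for i
    have no_ab: "(a i, b j) \<in> I \<longleftrightarrow> i = 0 \<and> j = 1 \<or> i = K \<and> Suc j = K"
      if "i \<le> K" "0 < j" "j < K" for i j
    proof
      assume ab: "(a i, b j) \<in> I"
      have "i = Suc j \<or> j = Suc i"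
        using adj_level[OF ab a(5) b(5)] that by auto
      then show "i = 0 \<and> j = 1 \<or> i = K \<and> Suc j = K"
      proof
        assume i: "i = Suc j"
        have False if "i \<noteq> K"
        proof (rule chord[of "b j" "a i" "b (Suc j)" j])
          show "(b j, a i) \<in> I" using ab incid_sym by blast
          show "a i \<noteq> b (Suc j)" using meet[of i "Suc j"] that i \<open>i \<le> K\<close> by auto
        qed (use i \<open>i \<le> K\<close> \<open>0 < j\<close> a(5) b(5,6) in auto)
        then show ?thesis using i by auto
      next
        assume j: "j = Suc i"
        have False if "i \<noteq> 0"
        proof (rule chord[of "a i" "b j" "a (Suc i)" i])
          show "b j \<noteq> a (Suc i)" using meet[of "Suc i" j] j \<open>j < K\<close> by auto
        qed (use j ab that \<open>j < K\<close> \<open>0 < j\<close> a(5,6) b(5) in auto)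
        then show ?thesis using j by auto
      qed
    next
      assume "i = 0 \<and> j = 1 \<or> i = K \<and> Suc j = K"
      then show "(a i, b j) \<in> I"
        using b(6)[of 0] a(1) b(1) b(6)[of j] incid_sym a(3) b(3) K by auto
    qed
    have aa: "(a i, a j) \<in> I \<longleftrightarrow> i = Suc j \<or> j = Suc i" if "i \<le> K" "j \<le> K" for i j
      using adj_level[of "a i" "a j" i j] a(5,6) incid_sym that by (metis Suc_le_lessD)
    have bb: "(b i, b j) \<in> I \<longleftrightarrow> i = Suc j \<or> j = Suc i" if "i \<le> K" "j \<le> K" for i j
      using adj_level[of "b i" "b j" i j] b(5,6) incid_sym that by (metis Suc_le_lessD)
    have sucmod: "j = Suc i mod (2 * K) \<longleftrightarrow> j = Suc i \<or> Suc i = 2 * K \<and> j = 0"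
      if "i < 2 * K" "j < 2 * K" for i j
      using that by (auto simp: mod_Suc)
    have "\<exists>\<Delta>. subgeometry \<Delta> \<Gamma> \<and> ordinary_polygon K \<Delta>"
    proof (rule cycle_subpolygon[OF K(1)])
      show "inj_on z {..<2 * K}"
      proof (rule inj_onI)
        have ends: "a i \<noteq> b j" if "i \<le> K" "0 < j" "j < K" for i j
          using meet[of i j] level[of "a i" i j] a(5)[of i] b(5)[of j] that
          by (metis less_imp_le neq0_conv order_le_less)
        fix i j assume "i \<in> {..<2 * K}" "j \<in> {..<2 * K}" and eq: "z i = z j"
        then have ij: "i < 2 * K" "j < 2 * K" by auto
        consider "i \<le> K" "j \<le> K" | "i \<le> K" "K < j" | "K < i" "j \<le> K" | "K < i" "K < j" by linarith
        then show "i = j"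
        proof cases
          case 1
          then show ?thesis using level[of "a i" i j] a(5)[of i] a(5)[of j] eq by (simp add: z_def)
        next
          case 2
          then show ?thesis using ends[of i "2 * K - j"] ij eq by (simp add: z_def)
        next
          case 3
          then show ?thesis using ends[of j "2 * K - i"] ij eq[symmetric] by (simp add: z_def)
        next
          case 4
          then have "2 * K - i = 2 * K - j"
            using level[of "b (2 * K - i)" "2 * K - i" "2 * K - j"] b(5)[of "2 * K - i"] b(5)[of "2 * K - j"] eq
            by (simp add: z_def)
          then show ?thesis using ij by linarith
        qed
      qed
      show "z i \<in> elements \<Gamma>" if "i < 2 * K" for i using a(4) b(4) that by (simp add: z_def)
      fix i j assume ij: "i < 2 * K" "j < 2 * K"
      consider "i \<le> K" "j \<le> K" | "i \<le> K" "K < j" | "K < i" "j \<le> K" | "K < i" "K < j" by linarith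
      then show "(z i, z j) \<in> I \<longleftrightarrow> j = Suc i mod (2 * K) \<or> i = Suc j mod (2 * K)"
        unfolding sucmod[OF ij] sucmod[OF ij(2,1)]
      proof cases
        case 1
        then show "(z i, z j) \<in> I \<longleftrightarrow>
          (j = Suc i \<or> Suc i = 2 * K \<and> j = 0) \<or> (i = Suc j \<or> Suc j = 2 * K \<and> i = 0)"
          using aa[OF 1] K by (auto simp: z_def)
      next
        case 2
        then have "(z i, z j) \<in> I \<longleftrightarrow> i = 0 \<and> 2 * K - j = 1 \<or> i = K \<and> Suc (2 * K - j) = K"
          using no_ab[of i "2 * K - j"] ij by (simp add: z_def)
        then show "(z i, z j) \<in> I \<longleftrightarrow>
          (j = Suc i \<or> Suc i = 2 * K \<and> j = 0) \<or> (i = Suc j \<or> Suc j = 2 * K \<and> i = 0)"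
          using 2 ij K by auto
      next
        case 3
        have "(z i, z j) \<in> I \<longleftrightarrow> (z j, z i) \<in> I" using incid_sym by blast
        also have "\<dots> \<longleftrightarrow> j = 0 \<and> 2 * K - i = 1 \<or> j = K \<and> Suc (2 * K - i) = K"
          using no_ab[of j "2 * K - i"] ij 3 by (simp add: z_def)
        finally show "(z i, z j) \<in> I \<longleftrightarrow>
          (j = Suc i \<or> Suc i = 2 * K \<and> j = 0) \<or> (i = Suc j \<or> Suc j = 2 * K \<and> i = 0)"
          using 3 ij K by auto
      next
        case 4
        then have "(z i, z j) \<in> I \<longleftrightarrow> 2 * K - i = Suc (2 * K - j) \<or> 2 * K - j = Suc (2 * K - i)"
          using bb[of "2 * K - i" "2 * K - j"] ij by (simp add: z_def)
        then show "(z i, z j) \<in> I \<longleftrightarrow>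
          (j = Suc i \<or> Suc i = 2 * K \<and> j = 0) \<or> (i = Suc j \<or> Suc j = 2 * K \<and> i = 0)"
          using 4 ij K by auto
      qed
    qed
    then show False using no_polygon K by blast
  qed
qed

end

text \<open>Of the two arcs between \<open>x\<close> and \<open>y\<close> on the cycle of length
  \<open>2 * k\<close>, one has length at most \<open>k\<close>.\<close>

lemma polygon_walk:
  assumes sub: "subgeometry \<Delta> \<Gamma>" and poly: "ordinary_polygon k \<Delta>"
    and x: "x \<in> elements \<Delta>" and y: "y \<in> elements \<Delta>"
  shows "\<exists>j\<le>k. (x, y) \<in> incid \<Gamma> ^^ j"
proof -
  obtain p l where pl: "bij_betw p {..<k} (points \<Delta>)" "bij_betw l {..<k} (lines \<Delta>)"
    "\<And>i j. i < k \<Longrightarrow> j < k \<Longrightarrow> (p i, l j) \<in> incid \<Delta> \<longleftrightarrow> i = j \<or> i = Suc j mod k"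
    and k: "2 \<le> k" and geo: "point_line_geometry \<Delta>"
    using poly unfolding ordinary_polygon_def by metis
  have inc: "incid \<Delta> \<subseteq> incid \<Gamma>" using sub unfolding subgeometry_def by blast
  have sym: "(u, v) \<in> incid \<Delta> \<Longrightarrow> (v, u) \<in> incid \<Delta>" for u v
    using geo unfolding point_line_geometry_def sym_def by blast
  \<comment> \<open>\<open>z\<close> runs around the polygon with period \<open>2 * k\<close>, so
    that walks may pass the starting position.\<close>
  define z where "z i = (if even i then p (i div 2 mod k) else l (i div 2 mod k))" for i
  have k0: "i mod k < k" for i using k by simp
  have step: "(z i, z (Suc i)) \<in> incid \<Delta>" for i
  proof (cases "even i")
    case True
    then show ?thesis using pl(3)[OF k0 k0] by (simp add: z_def)
  next
    case False
    then have "Suc i div 2 = Suc (i div 2)" by presburger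
    then have "(p (Suc i div 2 mod k), l (i div 2 mod k)) \<in> incid \<Delta>"
      using pl(3)[OF k0 k0] by (simp add: mod_Suc_eq)
    then show ?thesis using False sym by (simp add: z_def)
  qed
  have walk: "(z i, z (i + j)) \<in> incid \<Gamma> ^^ j" for i j
    unfolding relpow_fun_conv by (rule exI[of _ "\<lambda>r. z (i + r)"]) (use step inc in auto)
  have walk_back: "(z (i + j), z i) \<in> incid \<Gamma> ^^ j" for i j
  proof -
    have "(z (i + j - r), z (i + j - Suc r)) \<in> incid \<Gamma>" if "r < j" for r
    proof -
      have "i + j - r = Suc (i + j - Suc r)" using that by simp
      then show ?thesis using step[of "i + j - Suc r"] sym inc by auto
    qed
    then show ?thesis unfolding relpow_fun_conv by (intro exI[of _ "\<lambda>r. z (i + j - r)"]) auto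
  qed
  have period: "z (i + 2 * k) = z i" for i
    by (simp add: z_def)
  have onto: "\<exists>i<2 * k. u = z i" if "u \<in> elements \<Delta>" for u
  proof -
    have "u \<in> p ` {..<k} \<union> l ` {..<k}"
      using that pl(1,2) by (simp add: elements_def bij_betw_def)
    then consider i where "i < k" "u = p i" | i where "i < k" "u = l i" by auto
    then show ?thesis
    proof cases
      case 1
      then show ?thesis by (intro exI[of _ "2 * i"]) (simp add: z_def)
    next
      case 2
      then show ?thesis by (intro exI[of _ "Suc (2 * i)"]) (simp add: z_def)
    qed
  qed
  obtain i j where ij: "i < 2 * k" "x = z i" "j < 2 * k" "y = z j" using onto x y by metis
  consider "i \<le> j" "j \<le> i + k" | "i \<le> j" "i + k < j" | "j \<le> i" "i \<le> j + k" | "j \<le> i" "j + k < i"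
    by linarith
  then show ?thesis
  proof cases
    case 1
    then show ?thesis using walk[of i "j - i"] ij by (intro exI[of _ "j - i"]) auto
  next
    case 2
    then show ?thesis using walk_back[of j "i + 2 * k - j"] period[of i] ij
      by (intro exI[of _ "i + 2 * k - j"]) auto
  next
    case 3
    then show ?thesis using walk_back[of j "i - j"] ij by (intro exI[of _ "i - j"]) auto
  next
    case 4
    then show ?thesis using walk[of i "j + 2 * k - i"] period[of j] ij
      by (intro exI[of _ "j + 2 * k - i"]) auto
  qed
qed

text \<open>The common ordinary \<open>n\<close>-gons give connectedness and diameter at most
  \<open>n\<close>, the absence of smaller polygons gives unique steps, and points have
  \<open>t + 1 \<ge> s + 1\<close> neighbours.\<close>

lemma polygon_graph_of_geometry:
  assumes "weak_generalised_polygon n \<Gamma>" "finite_geometry \<Gamma>" "has_order \<Gamma> s t" "s \<le> t"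
  shows "connected_geometry \<Gamma>" "polygon_graph (elements \<Gamma>) (incid \<Gamma>) (walk_dist \<Gamma>) n s"
proof -
  have geo: "point_line_geometry \<Gamma>"
    and no_polygon: "\<And>k. 2 \<le> k \<Longrightarrow> k < n \<Longrightarrow> \<not> (\<exists>\<Delta>. subgeometry \<Delta> \<Gamma> \<and> ordinary_polygon k \<Delta>)"
    and apartment: "\<And>x y. x \<in> elements \<Gamma> \<Longrightarrow> y \<in> elements \<Gamma> \<Longrightarrow>
      \<exists>\<Delta>. subgeometry \<Delta> \<Gamma> \<and> ordinary_polygon n \<Delta> \<and> x \<in> elements \<Delta> \<and> y \<in> elements \<Delta>"
    using assms(1) unfolding weak_generalised_polygon_def by blast+
  have walk: "\<exists>j\<le>n. (x, y) \<in> incid \<Gamma> ^^ j" if "x \<in> elements \<Gamma>" "y \<in> elements \<Gamma>" for x y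
    using apartment[OF that] polygon_walk by metis
  then show "connected_geometry \<Gamma>" using geo by unfold_locales blast+
  then interpret connected_geometry \<Gamma> .
  have finE: "finite (elements \<Gamma>)"
    using assms(2) unfolding finite_geometry_def elements_def by simp
  show "polygon_graph (elements \<Gamma>) (incid \<Gamma>) (walk_dist \<Gamma>) n s"
  proof unfold_locales
    show "d x y \<le> n" if "x \<in> elements \<Gamma>" "y \<in> elements \<Gamma>" for x y
      using walk[OF that] by (meson walk_dist_le le_trans)
    show "z = z'" if "y \<in> elements \<Gamma>" "d x y < n" "(x, z) \<in> I" "(x, z') \<in> I"
      "d x y = Suc (d z y)" "d x y = Suc (d z' y)" for x y z z'
      using step_unique[OF no_polygon that] by blast
    show "finite {y. (x, y) \<in> I}" for x
      using finE incid_elements by (rule_tac finite_subset[of _ "elements \<Gamma>"]) auto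
    show "s + 1 \<le> card {y. (x, y) \<in> I}" if "x \<in> elements \<Gamma>" for x
    proof (cases "x \<in> points \<Gamma>")
      case True
      then have "card {y. (x, y) \<in> I} = t + 1" using point_degree assms(3) by blast
      then show ?thesis using assms(4) by simp
    next
      case False
      then have x: "x \<in> lines \<Gamma>" using that unfolding elements_def by blast
      have "{y. (x, y) \<in> I} = {p \<in> points \<Gamma>. (p, x) \<in> I}"
        using False incid_bipartite incid_sym by blast
      then show ?thesis using assms(3) x unfolding has_order_def by simp
    qed
    show "1 \<le> s" using assms(3) unfolding has_order_def by blast
    show "elements \<Gamma> \<noteq> {}" using geo unfolding point_line_geometry_def elements_def by blast
  qed (fact incid_elements incid_sym d_zero d_commute d_triangle d_adj step_exists)+
qed

section \<open>Transfer of the graph results back to points and lines\<close>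

theorem theorem2p16:
  fixes \<Gamma> :: "'a geometry" and m s t :: nat and C :: "'a set"
  assumes "m \<ge> 2"
    and "weak_generalised_polygon (2 * m) \<Gamma>"
    and "finite_geometry \<Gamma>"
    and "has_order \<Gamma> s t"
    and "s \<le> t"
    and "C \<subseteq> points \<Gamma>"
    and "\<forall>v\<in>points \<Gamma>. C \<inter> points_within \<Gamma> (2 * m - 2) v \<noteq> {}"
  shows "card C \<ge> s + 1 \<and>
    (card C = s + 1 \<longrightarrow>
       (\<exists>x y d. opposite (2 * m) \<Gamma> x y \<and> d \<in> {1..m} \<and> C = dist_trace \<Gamma> m d x y)) \<and>
    (card C = s + 1 \<and> s < t \<longrightarrow>
       (\<forall>x y d. opposite (2 * m) \<Gamma> x y \<and> d \<in> {1..m} \<and> C = dist_trace \<Gamma> m d x y \<longrightarrow> odd d))"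
proof -
  define n where "n = 2 * m"
  note poly = assms(2)[folded n_def] and block = assms(7)[folded n_def]
  interpret cg: connected_geometry \<Gamma>
    using polygon_graph_of_geometry(1)[OF poly assms(3,4,5)] .
  interpret pg: polygon_graph "elements \<Gamma>" "incid \<Gamma>" "walk_dist \<Gamma>" n s
    using polygon_graph_of_geometry(2)[OF poly assms(3,4,5)] .
  have finE: "finite (elements \<Gamma>)"
    using assms(3) unfolding finite_geometry_def elements_def by simp
  have points_elements: "p \<in> elements \<Gamma>" if "p \<in> points \<Gamma>" for p
    using that unfolding elements_def by blast
  have gdist: "gdist \<Gamma> x y = enat (cg.d x y)" if "x \<in> elements \<Gamma>" "y \<in> elements \<Gamma>" for x y
    using gdist_eq_walk_dist cg.walk_d that by metis
  have trace: "dist_trace \<Gamma> m i x y = {p \<in> points \<Gamma>. cg.d x p = i \<and> cg.d y p = n - i}"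
    if "x \<in> elements \<Gamma>" "y \<in> elements \<Gamma>" for x y i
    using that gdist points_elements unfolding dist_trace_def points_at_def n_def by auto
  have CE: "C \<subseteq> elements \<Gamma>" using assms(6) points_elements by blast
  interpret bs: blocking_set "elements \<Gamma>" "incid \<Gamma>" "walk_dist \<Gamma>" n s C
  proof unfold_locales
    show "C \<subseteq> elements \<Gamma>" by (fact CE)
    show "finite C" using CE finE by (rule finite_subset)
    show "even (cg.d c c')" if "c \<in> C" "c' \<in> C" for c c'
      using cg.even_d[of c c'] that CE assms(6) by blast
    show "\<exists>c\<in>C. cg.d x c < n" if "x \<in> elements \<Gamma>" for x
    proof (cases "x \<in> points \<Gamma>")
      case True
      then obtain c where "c \<in> C" "gdist \<Gamma> x c \<le> enat (n - 2)"
        using block unfolding points_within_def by blast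
      then show ?thesis using gdist[OF that, of c] CE assms(1) by (intro bexI[of _ c]) (auto simp: n_def)
    next
      \<comment> \<open>A line is at odd distance from every point whereas \<open>n\<close> is even,
        so any member of \<open>C\<close> serves.\<close>
      case False
      have "points \<Gamma> \<noteq> {}" using cg.geometry unfolding point_line_geometry_def by blast
      then obtain c where c: "c \<in> C" using block by blast
      then have "odd (cg.d x c)" using cg.even_d[OF that, of c] CE assms(6) False by blast
      then have "cg.d x c \<noteq> n" by (auto simp: n_def)
      then show ?thesis using pg.d_le[OF that, of c] c CE by (intro bexI[of _ c]) auto
    qed
  qed
  have "\<exists>x y i. opposite n \<Gamma> x y \<and> i \<in> {1..m} \<and> C = dist_trace \<Gamma> m i x y" if "card C = s + 1"
  proof -
    have tight: "tight_blocking_set (elements \<Gamma>) (incid \<Gamma>) (walk_dist \<Gamma>) n s C"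
      using that by (intro tight_blocking_set.intro bs.blocking_set_axioms tight_blocking_set_axioms.intro)
    obtain x y i where xyi: "x \<in> elements \<Gamma>" "y \<in> elements \<Gamma>" "cg.d x y = n" "1 \<le> i" "2 * i \<le> n"
      "C = {p \<in> elements \<Gamma>. cg.d x p = i \<and> cg.d y p = n - i}"
      by (rule tight_blocking_set.trace_exists[OF tight])
    then have "C = dist_trace \<Gamma> m i x y"
      using trace[of x y i] assms(6) points_elements by blast
    moreover have "opposite n \<Gamma> x y" using xyi gdist unfolding opposite_def by simp
    moreover have "i \<in> {1..m}" using xyi(4,5) by (simp add: n_def)
    ultimately show ?thesis by blast
  qed
  moreover have "odd i"
    if hyps: "card C = s + 1" "s < t" "opposite n \<Gamma> x y" "i \<in> {1..m}" "C = dist_trace \<Gamma> m i x y" for x y i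
  proof
    assume "even i"
    have E: "x \<in> elements \<Gamma>" "y \<in> elements \<Gamma>" and opp: "cg.d x y = n"
      using hyps(3) gdist[of x y] unfolding opposite_def by auto
    have "C \<noteq> {}" using hyps(1) by auto
    then obtain p where "p \<in> points \<Gamma>" "cg.d x p = i" using hyps(5) trace[OF E] by blast
    \<comment> \<open>An even \<open>i\<close> makes \<open>x\<close> a point, with
      \<open>t + 1\<close> neighbours.\<close>
    then have x: "x \<in> points \<Gamma>" using cg.even_d[OF E(1), of p] points_elements \<open>even i\<close> by blast
    \<comment> \<open>From a point, only points are at even distance, so the trace taken among all
      elements is still \<open>C\<close>; counting it gives
      \<open>t + 1 \<le> s + 1\<close>.\<close>
    have "q \<in> points \<Gamma>" if "q \<in> elements \<Gamma>" "cg.d x q = i" for q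
      using cg.even_d[OF E(1), of q] that x \<open>even i\<close> by blast
    then have "C = {p \<in> elements \<Gamma>. cg.d x p = i \<and> cg.d y p = n - i}"
      using hyps(5) trace[OF E] points_elements by blast
    moreover have "1 \<le> i" "2 * i \<le> n" using hyps(4) by (auto simp: n_def)
    ultimately have "card {u. (x, u) \<in> incid \<Gamma>} \<le> card C"
      using pg.degree_le_card_trace[OF E opp, of i] finE by simp
    then show False using cg.point_degree[OF assms(4) x] hyps(1,2) by simp
  qed
  ultimately show ?thesis using bs.card_ge unfolding n_def by blast
qed

end
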